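(* Let $1\leq d\leq \ell-1$ and let $C^d=\begin{bmatrix} C_1^d & \cdots & C_8^d\end{bmatrix}\in \mathrm{M}(\ell\times 8d, \mathbb{F}_q)$, where each block $C_i^d=\begin{bmatrix} C_{i,1}^d \\ C_{i,2}^d\end{bmatrix}\in\mathrm{M}(\ell\times d,\mathbb{F}_q)$ with $C_{i,1}^d$ a uniformly random symmetric $d\times d$ matrix and $C_{i,2}^d$ a uniformly random $(\ell-d)\times d$ matrix over $\mathbb{F}_q$, all chosen independently. Then $\binom{\ell}{d}_q\cdot \Pr[\mathrm{rk}(C^d)\leq d]\leq \frac{1}{q^{\Omega(\ell)}}$.
   Context: $\binom{\ell}{d}_q$ denotes the Gaussian binomial coefficient, i.e. the number of $d$-dimensional subspaces of $\mathbb{F}_q^\ell$. $\mathrm{M}(a\times b,\mathbb{F}_q)$ is the space of $a\times b$ matrices over $\mathbb{F}_q$. *)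

theory Defs
  imports
    "HOL-Probability.Probability"
    "HOL-Library.Landau_Symbols"
    "Jordan_Normal_Form.Missing_VectorSpace"
begin

text \<open>
  The finite field is a record \<open>F\<close> (rather than a type of class \<open>field\<close>), so that it can be
  quantified over inside a formula.  Indices start at 0, and an \<open>a\<close> by \<open>b\<close> matrix over \<open>F\<close> is an
  extensional function on index pairs (row, column).
\<close>

definition matrices :: "'a ring \<Rightarrow> nat \<Rightarrow> nat \<Rightarrow> (nat \<times> nat \<Rightarrow> 'a) set" where
  "matrices F a b = ({..<a} \<times> {..<b}) \<rightarrow>\<^sub>E carrier F"

definition symmetric_matrices :: "'a ring \<Rightarrow> nat \<Rightarrow> (nat \<times> nat \<Rightarrow> 'a) set" where
  "symmetric_matrices F d = {A \<in> matrices F d d. \<forall>i<d. \<forall>j<d. A (i, j) = A (j, i)}"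

abbreviation coord_space :: "'a ring \<Rightarrow> nat \<Rightarrow> ('a, nat \<Rightarrow> 'a) module" where
  "coord_space F n \<equiv> ring.func_space F {..<n}"

definition subspace_dim :: "'a ring \<Rightarrow> nat \<Rightarrow> (nat \<Rightarrow> 'a) set \<Rightarrow> nat" where
  "subspace_dim F n W = vectorspace.dim F (coord_space F n\<lparr>carrier := W\<rparr>)"

definition gaussian_binomial :: "'a ring \<Rightarrow> nat \<Rightarrow> nat \<Rightarrow> nat" where
  "gaussian_binomial F l d =
     card {W. subspace F W (coord_space F l) \<and> subspace_dim F l W = d}"

definition column :: "nat \<Rightarrow> (nat \<times> nat \<Rightarrow> 'a) \<Rightarrow> nat \<Rightarrow> nat \<Rightarrow> 'a" where
  "column a A j = (\<lambda>i\<in>{..<a}. A (i, j))"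

definition matrix_rank :: "'a ring \<Rightarrow> nat \<Rightarrow> nat \<Rightarrow> (nat \<times> nat \<Rightarrow> 'a) \<Rightarrow> nat" where
  "matrix_rank F a b A =
     subspace_dim F a (module.span F (coord_space F a) (column a A ` {..<b}))"

definition stack_block ::
    "nat \<Rightarrow> nat \<Rightarrow> (nat \<times> nat \<Rightarrow> 'a) \<times> (nat \<times> nat \<Rightarrow> 'a) \<Rightarrow> nat \<times> nat \<Rightarrow> 'a" where
  "stack_block l d B =
     (\<lambda>(i, j)\<in>{..<l} \<times> {..<d}. if i < d then fst B (i, j) else snd B (i - d, j))"

definition join_blocks :: "nat \<Rightarrow> nat \<Rightarrow> (nat \<Rightarrow> nat \<times> nat \<Rightarrow> 'a) \<Rightarrow> nat \<times> nat \<Rightarrow> 'a" where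
  "join_blocks l d B = (\<lambda>(i, j)\<in>{..<l} \<times> {..<8 * d}. B (j div d) (i, j mod d))"

definition random_block :: "'a ring \<Rightarrow> nat \<Rightarrow> nat \<Rightarrow> (nat \<times> nat \<Rightarrow> 'a) pmf" where
  "random_block F l d =
     map_pmf (stack_block l d)
       (pair_pmf (pmf_of_set (symmetric_matrices F d)) (pmf_of_set (matrices F (l - d) d)))"

definition random_C :: "'a ring \<Rightarrow> nat \<Rightarrow> nat \<Rightarrow> (nat \<times> nat \<Rightarrow> 'a) pmf" where
  "random_C F l d =
     map_pmf (join_blocks l d) (Pi_pmf {..<8} undefined (\<lambda>_. random_block F l d))"

end

theory Submission
  imports Defs
begin

text \<open>
  Write \<open>q\<close> for the order of the field. If the rank is at most \<open>d\<close>, then all columns lie in some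
  subspace \<open>W\<close> with \<open>q ^ d\<close> elements, and by independence of the blocks this has probability
  \<open>p ^ 8\<close>, where \<open>p\<close> is the probability that the columns of one block lie in \<open>W\<close>.
  Let \<open>r\<close> be the number of pivots (leading positions of vectors) of \<open>W\<close> among the first \<open>d\<close>
  coordinates, and \<open>k = d - r \<le> l - d\<close> the number of the others. A block with columns in \<open>W\<close> is
  determined by a symmetric \<open>r\<close> by \<open>r\<close> matrix and \<open>k\<close> rows of length \<open>d\<close>, and
  \<open>r * (r + 1) / 2 + k * d \<le> d * l / 2\<close>. Comparing with the number of all blocks gives
  \<open>p ^ 2 \<le> q ^ (- N)\<close> with \<open>N = d * (l - d + 1)\<close>. The number of possible \<open>W\<close> is at most \<open>q ^ N\<close>,
  so the product in question is at most \<open>q ^ (N + N - 4 * N)\<close>, and \<open>N \<ge> l\<close>.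
\<close>

section \<open>Cardinality and extension of subspaces\<close>

text \<open>Coordinates with respect to a finite basis \<open>B\<close> identify the space with the
  coefficient functions \<open>B \<rightarrow>\<^sub>E carrier K\<close>. A finite carrier generates
  itself, so such a basis exists.\<close>

lemma (in vectorspace) card_carrier_eq_order_power_dim:
  assumes "finite (carrier V)"
  shows "card (carrier V) = order K ^ dim"
proof -
  have "gen_set (carrier V)"
    using in_own_span span_is_subset2 by auto
  then have "fin_dim"
    using assms unfolding fin_dim_def by blast
  then obtain B where B: "finite B" "basis B"
    using finite_basis_exists by auto
  then have BV: "B \<subseteq> carrier V"
    unfolding basis_def by auto
  have uniq: "\<exists>!a. a \<in> B \<rightarrow>\<^sub>E carrier K \<and> lincomb a B = v" if "v \<in> carrier V" for v
    using basis_criterion[OF B(1) BV] B(2) that by auto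
  have closed: "lincomb a B \<in> carrier V" if "a \<in> B \<rightarrow>\<^sub>E carrier K" for a
    using that BV by (intro lincomb_closed) auto
  have "bij_betw (\<lambda>a. lincomb a B) (B \<rightarrow>\<^sub>E carrier K) (carrier V)"
    unfolding bij_betw_def inj_on_def using uniq closed by (blast intro!: set_eqI)
  then have "card (carrier V) = card (B \<rightarrow>\<^sub>E carrier K)"
    by (simp add: bij_betw_same_card)
  then show ?thesis
    using dim_basis[OF B] B(1) by (simp add: card_PiE order_def)
qed

text \<open>For a subspace \<open>W\<close> and a vector \<open>v\<close> this is the span of
  \<open>W\<close> and \<open>v\<close>, written so that its elements can be counted as pairs
  \<open>(w, a)\<close>.\<close>

definition (in vectorspace) adjoin :: "'c set \<Rightarrow> 'c \<Rightarrow> 'c set" where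
  "adjoin W v = {w \<oplus>\<^bsub>V\<^esub> a \<odot>\<^bsub>V\<^esub> v | w a. w \<in> W \<and> a \<in> carrier K}"

context vectorspace
begin

lemma subspaceI:
  assumes "W \<subseteq> carrier V" "\<zero>\<^bsub>V\<^esub> \<in> W"
    and "\<And>v w. v \<in> W \<Longrightarrow> w \<in> W \<Longrightarrow> v \<oplus>\<^bsub>V\<^esub> w \<in> W"
    and "\<And>c v. c \<in> carrier K \<Longrightarrow> v \<in> W \<Longrightarrow> c \<odot>\<^bsub>V\<^esub> v \<in> W"
  shows "subspace K W V"
  unfolding subspace_def submodule_def
  using assms vectorspace_axioms module_axioms by auto

lemma subspaceD:
  assumes "subspace K W V"
  shows "W \<subseteq> carrier V" "\<zero>\<^bsub>V\<^esub> \<in> W"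
    and "\<And>v w. v \<in> W \<Longrightarrow> w \<in> W \<Longrightarrow> v \<oplus>\<^bsub>V\<^esub> w \<in> W"
    and "\<And>c v. c \<in> carrier K \<Longrightarrow> v \<in> W \<Longrightarrow> c \<odot>\<^bsub>V\<^esub> v \<in> W"
  using assms unfolding subspace_def submodule_def by auto

lemma subspace_uminus:
  assumes "subspace K W V" "w \<in> W"
  shows "\<ominus>\<^bsub>V\<^esub> w \<in> W"
  using subspaceD[OF assms(1)] assms(2) smult_minus_1_back[of w] by auto

lemma subspace_minus:
  assumes "subspace K W V" "v \<in> W" "w \<in> W"
  shows "v \<ominus>\<^bsub>V\<^esub> w \<in> W"
  using subspaceD(3)[OF assms(1)] subspace_uminus[OF assms(1)] assms(2,3)
  by (simp add: a_minus_def)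

lemma subspace_adjoin:
  assumes W: "subspace K W V" and v: "v \<in> carrier V"
  shows "subspace K (adjoin W v) V"
proof (rule subspaceI)
  note WD = subspaceD[OF W]
  show "adjoin W v \<subseteq> carrier V"
    using WD(1) v by (auto simp: adjoin_def)
  have "\<zero>\<^bsub>V\<^esub> = \<zero>\<^bsub>V\<^esub> \<oplus>\<^bsub>V\<^esub> \<zero>\<^bsub>K\<^esub> \<odot>\<^bsub>V\<^esub> v" using v by simp
  then show "\<zero>\<^bsub>V\<^esub> \<in> adjoin W v"
    using WD(2) unfolding adjoin_def by blast
  fix x assume "x \<in> adjoin W v"
  then obtain w a where x: "x = w \<oplus>\<^bsub>V\<^esub> a \<odot>\<^bsub>V\<^esub> v" "w \<in> W" "a \<in> carrier K"
    by (auto simp: adjoin_def)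
  have wV: "w \<in> carrier V" using x WD by auto
  {
    fix y assume "y \<in> adjoin W v"
    then obtain w' b where y: "y = w' \<oplus>\<^bsub>V\<^esub> b \<odot>\<^bsub>V\<^esub> v" "w' \<in> W" "b \<in> carrier K"
      by (auto simp: adjoin_def)
    have "w' \<in> carrier V" using y WD by auto
    then have "x \<oplus>\<^bsub>V\<^esub> y = (w \<oplus>\<^bsub>V\<^esub> w') \<oplus>\<^bsub>V\<^esub> (a \<oplus>\<^bsub>K\<^esub> b) \<odot>\<^bsub>V\<^esub> v"
      using x y v wV by (simp add: smult_l_distr M.a_ac)
    then show "x \<oplus>\<^bsub>V\<^esub> y \<in> adjoin W v"
      using WD(3)[OF x(2) y(2)] x(3) y(3) unfolding adjoin_def by blast
  }
  fix c assume c: "c \<in> carrier K"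
  have "c \<odot>\<^bsub>V\<^esub> x = c \<odot>\<^bsub>V\<^esub> w \<oplus>\<^bsub>V\<^esub> (c \<otimes>\<^bsub>K\<^esub> a) \<odot>\<^bsub>V\<^esub> v"
    using x v wV c by (simp add: smult_r_distr smult_assoc1)
  then show "c \<odot>\<^bsub>V\<^esub> x \<in> adjoin W v"
    using WD(4)[OF c x(2)] x(3) c unfolding adjoin_def by blast
qed

lemma adjoin_subset:
  assumes "subspace K W' V" "W \<subseteq> W'" "v \<in> W'"
  shows "adjoin W v \<subseteq> W'"
  using subspaceD[OF assms(1)] assms(2,3) by (auto simp: adjoin_def)

lemma subset_adjoin:
  assumes "subspace K W V" "v \<in> carrier V"
  shows "W \<subseteq> adjoin W v"
proof
  fix w assume "w \<in> W"
  moreover from this have "w = w \<oplus>\<^bsub>V\<^esub> \<zero>\<^bsub>K\<^esub> \<odot>\<^bsub>V\<^esub> v"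
    using subspaceD(1)[OF assms(1)] assms(2) by auto
  ultimately show "w \<in> adjoin W v"
    unfolding adjoin_def by blast
qed

lemma smult_mem_subspace_cancel:
  assumes W: "subspace K W V" and a: "a \<in> carrier K" "a \<noteq> \<zero>\<^bsub>K\<^esub>"
    and v: "v \<in> carrier V" "a \<odot>\<^bsub>V\<^esub> v \<in> W"
  shows "v \<in> W"
proof -
  have "v = inv\<^bsub>K\<^esub> a \<odot>\<^bsub>V\<^esub> (a \<odot>\<^bsub>V\<^esub> v)"
    using mult_inverse[OF a(1) v(1) refl a(2)] .
  moreover have "inv\<^bsub>K\<^esub> a \<in> carrier K"
    using a by (simp add: field_Units)
  ultimately show ?thesis
    using subspaceD(4)[OF W _ v(2)] by metis
qed

text \<open>Subtraction puts \<open>(a - b) v\<close> into \<open>W\<close>; were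
  \<open>a - b\<close> nonzero, it could be cancelled and \<open>v\<close> would lie in
  \<open>W\<close>. This is the injectivity behind \<open>card_adjoin\<close>.\<close>

lemma smult_add_cancel:
  assumes W: "subspace K W V" and v: "v \<in> carrier V" "v \<notin> W"
    and "w \<in> W" "w' \<in> W" "a \<in> carrier K" "b \<in> carrier K"
    and eq: "w \<oplus>\<^bsub>V\<^esub> a \<odot>\<^bsub>V\<^esub> v = w' \<oplus>\<^bsub>V\<^esub> b \<odot>\<^bsub>V\<^esub> v"
  shows "w = w' \<and> a = b"
proof -
  note WD = subspaceD[OF W]
  have wV: "w \<in> carrier V" "w' \<in> carrier V" using assms WD by auto
  have "(a \<ominus>\<^bsub>K\<^esub> b) \<odot>\<^bsub>V\<^esub> v = a \<odot>\<^bsub>V\<^esub> v \<ominus>\<^bsub>V\<^esub> b \<odot>\<^bsub>V\<^esub> v"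
    using assms by (simp add: a_minus_def smult_l_distr smult_l_minus)
  also have "\<dots> = (\<ominus>\<^bsub>V\<^esub> w \<oplus>\<^bsub>V\<^esub> (w \<oplus>\<^bsub>V\<^esub> a \<odot>\<^bsub>V\<^esub> v)) \<ominus>\<^bsub>V\<^esub> b \<odot>\<^bsub>V\<^esub> v"
    using v assms(6,7) wV M.r_neg1[of w "a \<odot>\<^bsub>V\<^esub> v"] by simp
  also have "\<dots> = w' \<ominus>\<^bsub>V\<^esub> w"
    unfolding eq using assms wV 
    by (simp add: a_minus_def M.a_assoc M.r_neg) (simp add: M.a_comm)
  finally have "(a \<ominus>\<^bsub>K\<^esub> b) \<odot>\<^bsub>V\<^esub> v \<in> W"
    using subspace_minus[OF W] assms by simp
  moreover have "a \<ominus>\<^bsub>K\<^esub> b \<in> carrier K" using assms by simp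
  ultimately have "a \<ominus>\<^bsub>K\<^esub> b = \<zero>\<^bsub>K\<^esub>"
    using smult_mem_subspace_cancel[OF W _ _ v(1)] v(2) by blast
  then have "a = b" using assms by simp
  moreover from this have "w = w'" using eq wV assms by auto
  ultimately show ?thesis by simp
qed

lemma card_adjoin:
  assumes W: "subspace K W V" and v: "v \<in> carrier V" "v \<notin> W"
  shows "card (adjoin W v) = order K * card W"
proof -
  have "adjoin W v = (\<lambda>(w, a). w \<oplus>\<^bsub>V\<^esub> a \<odot>\<^bsub>V\<^esub> v) ` (W \<times> carrier K)"
    by (auto simp: adjoin_def)
  moreover have "inj_on (\<lambda>(w, a). w \<oplus>\<^bsub>V\<^esub> a \<odot>\<^bsub>V\<^esub> v) (W \<times> carrier K)"
    using smult_add_cancel[OF W v] by (auto intro!: inj_onI)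
  ultimately show ?thesis
    by (simp add: card_image card_cartesian_product order_def)
qed

text \<open>Each vector adjoined from outside multiplies the cardinality by \<open>order K\<close>,
  and such a vector exists as long as the cardinality is below that of the whole space.\<close>

lemma subspace_extend:
  assumes fin: "finite (carrier V)" "order K > 1" and "subspace K W V" "card W = order K ^ r"
    and "order K ^ (r + k) \<le> card (carrier V)"
  shows "\<exists>W'. subspace K W' V \<and> W \<subseteq> W' \<and> card W' = order K ^ (r + k)"
  using assms(5)
proof (induction k)
  case 0
  then show ?case using assms by auto
next
  case (Suc k)
  have lt: "order K ^ (r + k) < order K ^ (r + Suc k)"
    using fin by simp
  then obtain W' where W': "subspace K W' V" "W \<subseteq> W'" "card W' = order K ^ (r + k)"
    using Suc.IH Suc.prems by (meson le_trans less_imp_le)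
  have "W' \<noteq> carrier V" using W'(3) lt Suc.prems by auto
  then obtain v where v: "v \<in> carrier V" "v \<notin> W'" using subspaceD(1)[OF W'(1)] by auto
  show ?case
    using subspace_adjoin[OF W'(1) v(1)] subset_adjoin[OF W'(1) v(1)] card_adjoin[OF W'(1) v] W'
    by (intro exI[of _ "adjoin W' v"]) auto
qed

section \<open>Independent tuples and the number of subspaces\<close>

text \<open>Ordered tuples are grown at the head: the next vector only has to avoid the span of the
  earlier ones, so the number of choices is a difference of two cardinalities.\<close>

primrec list_span :: "'c list \<Rightarrow> 'c set" where
  "list_span [] = {\<zero>\<^bsub>V\<^esub>}"
| "list_span (v # xs) = adjoin (list_span xs) v"

primrec list_indpt :: "'c list \<Rightarrow> bool" where
  "list_indpt [] \<longleftrightarrow> True"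
| "list_indpt (v # xs) \<longleftrightarrow> v \<notin> list_span xs \<and> list_indpt xs"

lemma subspace_list_span:
  "set xs \<subseteq> carrier V \<Longrightarrow> subspace K (list_span xs) V"
  by (induction xs) (auto intro!: subspace_adjoin subspaceI)

lemma list_span_subset:
  "subspace K W V \<Longrightarrow> set xs \<subseteq> W \<Longrightarrow> list_span xs \<subseteq> W"
proof (induction xs)
  case Nil
  then show ?case using subspaceD(2) by auto
next
  case (Cons v xs)
  then show ?case using adjoin_subset[of W "list_span xs" v] by simp
qed

lemma card_list_span:
  "set xs \<subseteq> carrier V \<Longrightarrow> list_indpt xs \<Longrightarrow> card (list_span xs) = order K ^ length xs"
  by (induction xs) (auto simp: card_adjoin subspace_list_span)

text \<open>As long as fewer than \<open>d\<close> vectors are chosen, their span has at most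
  \<open>q ^ (d - 1)\<close> elements. Since \<open>q \<ge> 2\<close>, at least
  \<open>q ^ d - q ^ (d - 1) \<ge> q ^ (d - 1)\<close> choices remain, a bound that is a pure power
  of \<open>q\<close>.\<close>

lemma card_indpt_lists:
  assumes fin: "finite (carrier V)" "order K > 1"
    and W: "subspace K W V" "card W = order K ^ d" and "k \<le> d"
  shows "order K ^ ((d - 1) * k) \<le> card {xs. length xs = k \<and> set xs \<subseteq> W \<and> list_indpt xs}"
  using \<open>k \<le> d\<close>
proof (induction k)
  case 0
  have "{xs. length xs = 0 \<and> set xs \<subseteq> W \<and> list_indpt xs} = {[]}" by auto
  then show ?case by simp
next
  case (Suc k)
  let ?L = "\<lambda>k. {xs. length xs = k \<and> set xs \<subseteq> W \<and> list_indpt xs}"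
  have WV: "W \<subseteq> carrier V" using subspaceD(1)[OF W(1)] .
  have finW: "finite W" using WV fin finite_subset by auto
  have finL: "finite (?L k)"
    by (rule finite_subset[OF _ finite_lists_length_eq[OF finW, of k]]) auto
  have step: "order K ^ (d - 1) \<le> card (W - list_span xs)" if "xs \<in> ?L k" for xs
  proof -
    have sub: "list_span xs \<subseteq> W" using list_span_subset[OF W(1)] that by auto
    have "card (list_span xs) = order K ^ k" using card_list_span that WV by auto
    also have "\<dots> \<le> order K ^ (d - 1)" using Suc.prems fin by (intro power_increasing) auto
    finally have "card (list_span xs) \<le> order K ^ (d - 1)" .
    moreover have "2 * order K ^ (d - 1) \<le> card W"
    proof -
      have "2 * order K ^ (d - 1) \<le> order K * order K ^ (d - 1)"
        using fin by (intro mult_right_mono) auto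
      then show ?thesis using W(2) Suc.prems by (metis Suc_le_D diff_Suc_1 power_Suc)
    qed
    moreover have "card (W - list_span xs) = card W - card (list_span xs)"
      using sub finW by (meson card_Diff_subset finite_subset)
    ultimately show ?thesis by linarith
  qed
  have "order K ^ ((d - 1) * Suc k) = order K ^ ((d - 1) * k) * order K ^ (d - 1)"
    by (simp add: power_add)
  also have "\<dots> \<le> card (?L k) * order K ^ (d - 1)"
    using Suc by (intro mult_right_mono) auto
  also have "\<dots> = (\<Sum>xs\<in>?L k. order K ^ (d - 1))" by simp
  also have "\<dots> \<le> (\<Sum>xs\<in>?L k. card (W - list_span xs))"
    by (rule sum_mono[OF step])
  also have "\<dots> = card (SIGMA xs:?L k. W - list_span xs)"
    using finL finW by simp
  also have "\<dots> = card ((\<lambda>(xs, v). v # xs) ` (SIGMA xs:?L k. W - list_span xs))"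
    by (rule card_image[symmetric]) (auto intro!: inj_onI)
  also have "\<dots> \<le> card (?L (Suc k))"
  proof (rule card_mono)
    show "finite (?L (Suc k))"
      by (rule finite_subset[OF _ finite_lists_length_eq[OF finW, of "Suc k"]]) auto
  qed auto
  finally show ?case .
qed

text \<open>
  Double counting of independent \<open>d\<close>-tuples: each of them spans a single subspace, and each subspace
  contains at least \<open>q ^ ((d - 1) * d)\<close> of them, because each of the \<open>d\<close> choices avoids at most
  \<open>q ^ (d - 1)\<close> of the \<open>q ^ d\<close> vectors.
\<close>
lemma card_subspaces_le:
  assumes fin: "finite (carrier V)" "order K > 1"
  shows "order K ^ ((d - 1) * d) * card {W. subspace K W V \<and> card W = order K ^ d}
    \<le> card (carrier V) ^ d"
proof -
  let ?S = "{W. subspace K W V \<and> card W = order K ^ d}"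
  let ?L = "\<lambda>W. {xs. length xs = d \<and> set xs \<subseteq> W \<and> list_indpt xs}"
  have sub: "?S \<subseteq> Pow (carrier V)" using subspaceD(1) by auto
  have finS: "finite ?S" using sub fin by (meson finite_Pow_iff finite_subset)
  have finW: "finite W" if "W \<in> ?S" for W
    using that sub fin(1) by (auto intro: finite_subset)
  \<comment> \<open>The span of such a tuple is a subset of \<open>W\<close> with
    \<open>q ^ d\<close> elements, hence all of \<open>W\<close>. This makes the sets
    \<open>?L W\<close> disjoint.\<close>
  have span_eq: "list_span xs = W" if "W \<in> ?S" "xs \<in> ?L W" for W xs
  proof (rule card_subset_eq)
    show "finite W" by (rule finW[OF that(1)])
    show "list_span xs \<subseteq> W" using list_span_subset that by auto
    have "set xs \<subseteq> carrier V" using that sub by auto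
    then show "card (list_span xs) = card W" using card_list_span that by auto
  qed
  have finL: "finite (?L W)" if "W \<in> ?S" for W
    by (rule finite_subset[OF _ finite_lists_length_eq[OF finW[OF that], of d]]) auto
  have "order K ^ ((d - 1) * d) * card ?S = (\<Sum>W\<in>?S. order K ^ ((d - 1) * d))" by simp
  also have "\<dots> \<le> (\<Sum>W\<in>?S. card (?L W))"
    by (rule sum_mono) (use card_indpt_lists[OF fin _ _ order_refl] in auto)
  also have "\<dots> = card (\<Union>W\<in>?S. ?L W)"
  proof (rule card_UN_disjoint[symmetric])
    show "\<forall>i\<in>?S. \<forall>j\<in>?S. i \<noteq> j \<longrightarrow> ?L i \<inter> ?L j = {}"
      using span_eq by blast
  qed (use finS finL in auto)
  also have "\<dots> \<le> card {xs. set xs \<subseteq> carrier V \<and> length xs = d}"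
    by (rule card_mono) (use finite_lists_length_eq[OF fin(1)] sub in auto)
  also have "\<dots> = card (carrier V) ^ d"
    by (rule card_lists_length_eq[OF fin(1)])
  finally show ?thesis .
qed

end

section \<open>Pivots of a subspace\<close>

text \<open>For a subspace these are the pivot positions of its echelon form: the difference of
  \<open>v\<close> and \<open>w\<close> has its first nonzero entry at \<open>i\<close>. Comparing
  two vectors directly keeps the notion free of ring operations.\<close>

definition pivots :: "nat \<Rightarrow> (nat \<Rightarrow> 'a) set \<Rightarrow> nat set" where
  "pivots n W = {i. i < n \<and> (\<exists>v\<in>W. \<exists>w\<in>W. (\<forall>j<i. v j = w j) \<and> v i \<noteq> w i)}"

lemma finite_pivots [simp]: "finite (pivots n W)"
  by (rule finite_subset[of _ "{..<n}"]) (auto simp: pivots_def)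

text \<open>The first position where \<open>v\<close> and \<open>w\<close> differ would be a pivot.
  The bound \<open>k\<close> allows an initial segment of the coordinates to be treated with its own
  pivots alone.\<close>

lemma agree_on_pivots:
  assumes "v \<in> W" "w \<in> W" "k \<le> n"
    and agree: "\<And>i. i \<in> pivots n W \<Longrightarrow> i < k \<Longrightarrow> v i = w i"
    and "i < k"
  shows "v i = w i"
  using \<open>i < k\<close>
proof (induction i rule: less_induct)
  case (less i)
  then show ?case
    using assms(1-3) agree[of i] by (force simp: pivots_def)
qed

text \<open>The pairs with \<open>i \<le> j\<close> and their transposes cover the square and
  overlap in the diagonal. Such pairs index the free entries of a symmetric matrix.\<close>

lemma card_ordered_pairs:
  fixes P :: "nat set"
  assumes "finite P"
  shows "2 * card {(i, j). i \<in> P \<and> j \<in> P \<and> i \<le> j} = card P * (card P + 1)"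
proof -
  let ?L = "{(i, j). i \<in> P \<and> j \<in> P \<and> i \<le> j}"
  let ?G = "{(i, j). i \<in> P \<and> j \<in> P \<and> j \<le> i}"
  have sub: "?L \<subseteq> P \<times> P" "?G \<subseteq> P \<times> P" by auto
  have fin: "finite ?L" "finite ?G"
    using finite_subset[OF sub(1)] finite_subset[OF sub(2)] assms by auto
  have un: "?L \<union> ?G = P \<times> P" by auto
  have int: "?L \<inter> ?G = (\<lambda>i. (i, i)) ` P" by auto
  have "?G = prod.swap ` ?L" by auto
  then have "card ?G = card ?L" by (simp add: card_image)
  moreover have "card (?L \<inter> ?G) = card P"
    unfolding int by (rule card_image) (auto intro!: inj_onI)
  moreover have "card ?L + card ?G = card (P \<times> P) + card (?L \<inter> ?G)"
    using card_Un_Int[OF fin] un by simp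
  ultimately show ?thesis by (simp add: card_cartesian_product algebra_simps)
qed

context field
begin

lemma vectorspace_func_space: "vectorspace R (func_space S)"
  by (intro vectorspace.intro func_space_is_module field_axioms)

lemma card_carrier_func_space:
  "finite S \<Longrightarrow> card (carrier (func_space S)) = order R ^ card S"
  by (simp add: func_space_def card_PiE order_def)

text \<open>The vectors of \<open>W\<close> that vanish on the first \<open>k\<close> coordinates
  form a decreasing chain \<open>Z k\<close>. At each pivot the cardinality drops by a factor of at
  least \<open>q\<close>, and the product of these factors is at most \<open>card W\<close>.\<close>

lemma order_power_card_pivots_le:
  assumes fin: "finite (carrier R)" and W: "subspace R W (func_space {..<n})"
  shows "order R ^ card (pivots n W) \<le> card W"
proof -
  interpret V: vectorspace R "func_space {..<n}" by (rule vectorspace_func_space)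
  note WD = V.subspaceD[OF W]
  have WE: "W \<subseteq> {..<n} \<rightarrow>\<^sub>E carrier R" using WD(1) by (simp add: func_space_def)
  have finW: "finite W" by (rule finite_subset[OF WE]) (simp add: finite_PiE fin)
  define Z where "Z k = {w \<in> W. \<forall>j<k. w j = \<zero>}" for k
  have Z_sub: "subspace R (Z k) (func_space {..<n})" if "k \<le> n" for k
  proof (rule V.subspaceI)
    show "Z k \<subseteq> carrier (func_space {..<n})" using WD(1) by (auto simp: Z_def)
    show "\<zero>\<^bsub>func_space {..<n}\<^esub> \<in> Z k"
      using WD(2) that by (auto simp: Z_def func_space_def)
    show "v \<oplus>\<^bsub>func_space {..<n}\<^esub> w \<in> Z k" if "v \<in> Z k" "w \<in> Z k" for v w
      using WD(3)[of v w] that \<open>k \<le> n\<close> by (auto simp: Z_def func_space_def)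
    show "c \<odot>\<^bsub>func_space {..<n}\<^esub> v \<in> Z k" if "c \<in> carrier R" "v \<in> Z k" for c v
      using WD(4)[of c v] that \<open>k \<le> n\<close> by (auto simp: Z_def func_space_def)
  qed
  have "order R ^ card (pivots n W \<inter> {..<k}) * card (Z k) \<le> card W" if "k \<le> n" for k
    using that
  proof (induction k)
    case 0
    then show ?case by (simp add: Z_def)
  next
    case (Suc k)
    have IH: "order R ^ card (pivots n W \<inter> {..<k}) * card (Z k) \<le> card W"
      using Suc by simp
    show ?case
    proof (cases "k \<in> pivots n W")
      case True
      then obtain v w where vw: "v \<in> W" "w \<in> W" "\<forall>j<k. v j = w j" "v k \<noteq> w k"
        by (auto simp: pivots_def)
      \<comment> \<open>The difference of the two witnesses vanishes before \<open>k\<close> but not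
        at \<open>k\<close>. Adjoining it to \<open>Z (Suc k)\<close> therefore gives
        \<open>q\<close> times as many vectors, all of them still in \<open>Z k\<close>.\<close>
      define u where "u = v \<oplus>\<^bsub>func_space {..<n}\<^esub> (\<ominus> \<one>) \<odot>\<^bsub>func_space {..<n}\<^esub> w"
      have uW: "u \<in> W" unfolding u_def using WD(3,4) vw by simp
      have carr: "v j \<in> carrier R" "w j \<in> carrier R" if "j < n" for j
        using vw(1,2) WE that by auto
      have uj: "u j = v j \<ominus> w j" if "j < n" for j
        using that carr[OF that] by (simp add: u_def func_space_def a_minus_def l_minus)
      have uZ: "u \<in> Z k" using uW uj vw carr Suc.prems by (auto simp: Z_def r_neg a_minus_def)
      have "u k \<noteq> \<zero>" using uj[of k] vw(4) carr[of k] Suc.prems by auto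
      then have unZ: "u \<notin> Z (Suc k)" by (auto simp: Z_def)
      have "order R * card (Z (Suc k)) = card (V.adjoin (Z (Suc k)) u)"
        using V.card_adjoin[OF Z_sub[OF Suc.prems] _ unZ] uW WD(1) by auto
      also have "\<dots> \<le> card (Z k)"
      proof (rule card_mono)
        show "finite (Z k)" using finW by (simp add: Z_def)
        show "V.adjoin (Z (Suc k)) u \<subseteq> Z k"
          using Suc.prems uZ by (intro V.adjoin_subset Z_sub) (auto simp: Z_def)
      qed
      finally have le: "order R * card (Z (Suc k)) \<le> card (Z k)" .
      have "pivots n W \<inter> {..<Suc k} = insert k (pivots n W \<inter> {..<k})"
        using True by (auto simp: less_Suc_eq)
      then have "order R ^ card (pivots n W \<inter> {..<Suc k}) * card (Z (Suc k))
          = order R ^ card (pivots n W \<inter> {..<k}) * (order R * card (Z (Suc k)))"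
        by simp
      also have "\<dots> \<le> order R ^ card (pivots n W \<inter> {..<k}) * card (Z k)"
        using le by (rule mult_left_mono) simp
      finally show ?thesis using IH by simp
    next
      case False
      \<comment> \<open>Comparison with the zero vector: a nonzero entry at \<open>k\<close> would
        make \<open>k\<close> a pivot. So the chain does not shrink here.\<close>
      have "w k = \<zero>" if "w \<in> Z k" for w
      proof (rule ccontr)
        assume "w k \<noteq> \<zero>"
        then have "(\<forall>j<k. w j = \<zero>\<^bsub>func_space {..<n}\<^esub> j) \<and> w k \<noteq> \<zero>\<^bsub>func_space {..<n}\<^esub> k"
          using that Suc.prems by (auto simp: Z_def func_space_def)
        moreover have "w \<in> W" using that by (simp add: Z_def)
        ultimately have "k \<in> pivots n W"
          using WD(2) Suc.prems unfolding pivots_def mem_Collect_eq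
          by (meson Suc_le_eq)
        then show False using False by simp
      qed
      then have "Z (Suc k) = Z k" by (auto simp: Z_def less_Suc_eq)
      moreover have "pivots n W \<inter> {..<Suc k} = pivots n W \<inter> {..<k}"
        using False by (auto simp: less_Suc_eq)
      ultimately show ?thesis using IH by simp
    qed
  qed
  from this[of n] have "order R ^ card (pivots n W) * card (Z n) \<le> card W"
    by (simp add: pivots_def Int_absorb2 subset_iff)
  moreover have "card (Z n) \<ge> 1"
  proof -
    have "Z n \<noteq> {}" using V.subspaceD(2)[OF Z_sub[of n]] by auto
    then show ?thesis using finW by (simp add: Z_def Suc_le_eq card_gt_0_iff)
  qed
  ultimately show ?thesis
    by (metis le_trans mult.right_neutral mult_le_mono2)
qed

end

section \<open>Counting blocks whose columns lie in a subspace\<close>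

text \<open>Here \<open>r\<close> and \<open>k\<close> stand for the numbers of pivots in the top
  and bottom rows of a block, and the left side is twice the number of free entries. With
  \<open>r\<close> raised to \<open>d - k\<close> it becomes
  \<open>d * (d + 1) + k * (k - 1)\<close>, and the claim reduces to
  \<open>k * (k - 1) \<le> d * (l - d - 1)\<close>.\<close>

lemma triangle_plus_rectangle_le:
  fixes r k d l :: nat
  assumes "r + k \<le> d" "k \<le> l - d" "d < l"
  shows "r * (r + 1) + 2 * (k * d) \<le> d * l"
proof -
  define s where "s = d - k"
  define m where "m = l - d - 1"
  have d: "d = s + k" and l: "l = d + 1 + m" and "r \<le> s"
    using assms by (auto simp: s_def m_def)
  have "k * (k - 1) \<le> d * m"
    using assms by (intro mult_mono) (auto simp: m_def)
  then have "k * k \<le> k + d * m" by (cases k) auto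
  moreover have "r * (r + 1) \<le> s * (s + 1)" using \<open>r \<le> s\<close> by (intro mult_mono) auto
  moreover have "s * (s + 1) + 2 * (k * d) + k = d * (d + 1) + k * k"
    unfolding d by (simp add: algebra_simps)
  moreover have "d * l = d * (d + 1) + d * m" unfolding l by (simp add: algebra_simps)
  ultimately show ?thesis by linarith
qed

lemma stack_block_top: "i < d \<Longrightarrow> d \<le> l \<Longrightarrow> j < d \<Longrightarrow> stack_block l d (A, B) (i, j) = A (i, j)"
  by (simp add: stack_block_def)

lemma stack_block_bottom:
  "i < l - d \<Longrightarrow> j < d \<Longrightarrow> stack_block l d (A, B) (i + d, j) = B (i, j)"
  by (simp add: stack_block_def less_diff_conv)

locale finite_field = field F for F :: "'a ring" (structure) +
  assumes finite_carrier: "finite (carrier F)"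
begin

lemma order_gt_1: "order F > 1"
proof -
  have "card {\<zero>, \<one>} \<le> order F"
    unfolding order_def by (rule card_mono) (auto simp: finite_carrier)
  then show ?thesis using zero_not_one by simp
qed

lemma finite_coord_space: "finite (carrier (func_space {..<n :: nat}))"
  by (auto simp: func_space_def intro!: finite_PiE finite_carrier)

lemma finite_matrices: "finite (matrices F a b)"
  unfolding matrices_def by (intro finite_PiE) (auto simp: finite_carrier)

lemma card_matrices: "card (matrices F a b) = order F ^ (a * b)"
  by (simp add: matrices_def card_PiE order_def)

lemma finite_symmetric_matrices: "finite (symmetric_matrices F d)"
  unfolding symmetric_matrices_def using finite_matrices by simp

text \<open>Any choice of an upper triangle, mirrored, gives a symmetric matrix. A lower bound
  suffices because the count becomes a denominator, and squaring clears the half in the exponent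
  \<open>d * (d + 1) / 2\<close>.\<close>

lemma order_power_le_card_symmetric_matrices_sq:
  "order F ^ (d * (d + 1)) \<le> card (symmetric_matrices F d) ^ 2"
proof -
  let ?T = "{(i, j). i \<in> {..<d} \<and> j \<in> {..<d} \<and> i \<le> j}"
  let ?g = "\<lambda>A. \<lambda>(i, j)\<in>{..<d} \<times> {..<d}. if i \<le> j then A (i, j) else A (j, i)"
  have finT: "finite ?T" by (rule finite_subset[of _ "{..<d} \<times> {..<d}"]) auto
  have inj: "inj_on ?g (?T \<rightarrow>\<^sub>E carrier F)"
  proof (rule inj_onI)
    fix A B assume A: "A \<in> ?T \<rightarrow>\<^sub>E carrier F" and B: "B \<in> ?T \<rightarrow>\<^sub>E carrier F" and eq: "?g A = ?g B"
    show "A = B"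
    proof (rule PiE_ext[OF A B])
      fix x assume "x \<in> ?T"
      then show "A x = B x" using fun_cong[OF eq, of x] by auto
    qed
  qed
  have "order F ^ card ?T = card (?T \<rightarrow>\<^sub>E carrier F)"
    using finT by (simp add: card_PiE order_def)
  also have "\<dots> \<le> card (symmetric_matrices F d)"
  proof (rule card_inj_on_le[OF inj])
    show "?g ` (?T \<rightarrow>\<^sub>E carrier F) \<subseteq> symmetric_matrices F d"
      by (auto simp: symmetric_matrices_def matrices_def PiE_iff)
  qed (rule finite_symmetric_matrices)
  finally have "(order F ^ card ?T) ^ 2 \<le> card (symmetric_matrices F d) ^ 2"
    by (intro power_mono) auto
  moreover have "2 * card ?T = d * (d + 1)"
    using card_ordered_pairs[of "{..<d}"] by simp
  ultimately show ?thesis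
    by (simp only: power_mult[symmetric] mult.commute[of "card ?T" 2])
qed

lemma symmetric_matrices_nonempty: "symmetric_matrices F d \<noteq> {}"
proof -
  have "(\<lambda>_\<in>{..<d} \<times> {..<d}. \<zero>) \<in> symmetric_matrices F d"
    by (auto simp: symmetric_matrices_def matrices_def)
  then show ?thesis by blast
qed

lemma matrices_nonempty: "matrices F a b \<noteq> {}"
  unfolding matrices_def using zero_closed by (auto simp: PiE_eq_empty_iff)

lemma stack_block_in_matrices:
  assumes "A \<in> matrices F d d" "B \<in> matrices F (l - d) d"
  shows "stack_block l d (A, B) \<in> matrices F l d"
  using assms by (auto simp: matrices_def stack_block_def PiE_iff)

text \<open>
  The entries in the pivot rows determine a block whose columns lie in \<open>W\<close>. Since the top square
  is symmetric, its pivot rows are determined in turn by their entries in the pivot columns.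
\<close>
lemma card_blocks_in_subspace_sq_le:
  assumes "d < l"
    and W: "subspace F W (func_space {..<l})" "card W = order F ^ d"
  shows "card {X \<in> symmetric_matrices F d \<times> matrices F (l - d) d.
      \<forall>j<d. column l (stack_block l d X) j \<in> W} ^ 2 \<le> order F ^ (d * l)"
    (is "card ?X ^ 2 \<le> _")
proof -
  define P where "P = pivots l W"
  define P1 where "P1 = P \<inter> {..<d}"
  define P2 where "P2 = P - {..<d}"
  \<comment> \<open>The free entries: one of each transposed pair in the pivot rows and columns of
    the top square, and the full rows at the lower pivots.\<close>
  define Q1 where "Q1 = {(i, j). i \<in> P1 \<and> j \<in> P1 \<and> i \<le> j}"
  define Q where "Q = Q1 \<union> P2 \<times> {..<d}"
  have P_lt: "i < l" if "i \<in> P" for i using that by (auto simp: P_def pivots_def)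
  have finP: "finite P1" "finite P2" by (auto simp: P1_def P2_def P_def)
  have finQ1: "finite Q1"
    by (rule finite_subset[of _ "P1 \<times> P1"]) (auto simp: Q1_def finP)
  have finQ: "finite Q" using finQ1 finP by (simp add: Q_def)
  let ?C = "stack_block l d"
  have sym: "?C X (i, j) = ?C X (j, i)" if "X \<in> ?X" "i < d" "j < d" for X i j
    using that \<open>d < l\<close> by (cases X) (auto simp: stack_block_top symmetric_matrices_def)
  have inj: "inj_on (\<lambda>X. restrict (?C X) Q) ?X"
  proof (rule inj_onI)
    fix X Y assume X: "X \<in> ?X" and Y: "Y \<in> ?X" and eq: "restrict (?C X) Q = restrict (?C Y) Q"
    have eqQ: "?C X x = ?C Y x" if "x \<in> Q" for x
      using fun_cong[OF eq, of x] that by simp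
    \<comment> \<open>Within one column from \<open>W\<close>, the first \<open>k\<close> entries
      are fixed by those at pivots below \<open>k\<close>. The cut-off is used with \<open>d\<close>
      for the top square and with \<open>l\<close> for whole columns.\<close>
    have agree: "?C X (i, j) = ?C Y (i, j)"
      if "j < d" "k \<le> l" "i < k" "\<And>p. p \<in> P \<Longrightarrow> p < k \<Longrightarrow> ?C X (p, j) = ?C Y (p, j)" for i j k
    proof -
      have "column l (?C X) j \<in> W" "column l (?C Y) j \<in> W"
        using X Y \<open>j < d\<close> by blast+
      then have "column l (?C X) j i = column l (?C Y) j i"
      proof (rule agree_on_pivots[OF _ _ \<open>k \<le> l\<close> _ \<open>i < k\<close>])
        fix p assume "p \<in> pivots l W" "p < k"
        then show "column l (?C X) j p = column l (?C Y) j p"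
          using that(4)[of p] by (simp add: P_def column_def)
      qed
      then show ?thesis using that by (simp add: column_def)
    qed
    \<comment> \<open>The cut-off \<open>d\<close> leaves only the pivots of the top square, and
      there either \<open>(p, j)\<close> or its transpose lies in \<open>Q1\<close>.\<close>
    have pivot_column: "?C X (i, j) = ?C Y (i, j)" if "i < d" "j \<in> P1" for i j
    proof (rule agree[of j d])
      fix p assume p: "p \<in> P" "p < d"
      show "?C X (p, j) = ?C Y (p, j)"
      proof (cases "p \<le> j")
        case True
        then have "(p, j) \<in> Q" using p that by (auto simp: Q_def Q1_def P1_def)
        then show ?thesis by (rule eqQ)
      next
        case False
        then have "(j, p) \<in> Q" using p that by (auto simp: Q_def Q1_def P1_def)
        then have "?C X (j, p) = ?C Y (j, p)" by (rule eqQ)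
        then show ?thesis using sym[OF X, of p j] sym[OF Y, of p j] p that by (simp add: P1_def)
      qed
    qed (use that \<open>d < l\<close> in \<open>auto simp: P1_def\<close>)
    \<comment> \<open>A pivot row of the top square is by symmetry a pivot column, which is already
      settled; the rows at lower pivots lie in \<open>Q\<close>.\<close>
    have all: "?C X (i, j) = ?C Y (i, j)" if "i < l" "j < d" for i j
    proof (rule agree[of j l])
      fix p assume p: "p \<in> P" "p < l"
      show "?C X (p, j) = ?C Y (p, j)"
      proof (cases "p < d")
        case True
        then have "?C X (j, p) = ?C Y (j, p)" using pivot_column that p by (simp add: P1_def)
        then show ?thesis using sym[OF X, of p j] sym[OF Y, of p j] True that by simp
      next
        case False
        then show ?thesis using p that by (intro eqQ) (auto simp: Q_def P2_def)
      qed
    qed (use that in auto)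
    obtain S M S' M' where XY: "X = (S, M)" "Y = (S', M')" by (metis surj_pair)
    have "S = S'"
    proof (rule PiE_ext)
      show "S \<in> {..<d} \<times> {..<d} \<rightarrow>\<^sub>E carrier F" "S' \<in> {..<d} \<times> {..<d} \<rightarrow>\<^sub>E carrier F"
        using X Y XY by (auto simp: symmetric_matrices_def matrices_def)
      show "S x = S' x" if "x \<in> {..<d} \<times> {..<d}" for x
        using that all[of "fst x" "snd x"] \<open>d < l\<close> XY
        by (auto simp: stack_block_top)
    qed
    moreover have "M = M'"
    proof (rule PiE_ext)
      show "M \<in> {..<l - d} \<times> {..<d} \<rightarrow>\<^sub>E carrier F" "M' \<in> {..<l - d} \<times> {..<d} \<rightarrow>\<^sub>E carrier F"
        using X Y XY by (auto simp: matrices_def)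
      show "M x = M' x" if "x \<in> {..<l - d} \<times> {..<d}" for x
        using that all[of "fst x + d" "snd x"] \<open>d < l\<close> XY
        by (auto simp: stack_block_bottom)
    qed
    ultimately show "X = Y" using XY by simp
  qed
  have "card ?X \<le> card (Q \<rightarrow>\<^sub>E carrier F)"
  proof (rule card_inj_on_le[OF inj])
    have "Q \<subseteq> {..<l} \<times> {..<d}"
      using P_lt \<open>d < l\<close> by (auto simp: Q_def Q1_def P1_def P2_def)
    moreover have "?C X \<in> {..<l} \<times> {..<d} \<rightarrow> carrier F" if "X \<in> ?X" for X
      using that stack_block_in_matrices
      by (cases X) (auto simp: symmetric_matrices_def matrices_def PiE_def)
    ultimately show "(\<lambda>X. restrict (?C X) Q) ` ?X \<subseteq> Q \<rightarrow>\<^sub>E carrier F"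
      by (intro image_subsetI) (metis (no_types, lifting) restrict_PiE_iff Pi_iff subsetD)
    show "finite (Q \<rightarrow>\<^sub>E carrier F)" using finQ finite_carrier by (intro finite_PiE) auto
  qed
  also have "\<dots> = order F ^ card Q" using finQ by (simp add: card_PiE order_def)
  finally have "card ?X ^ 2 \<le> (order F ^ card Q) ^ 2"
    by (rule power_mono) (rule zero_le)
  also have "\<dots> = order F ^ (2 * card Q)" by (simp add: power_mult mult.commute)
  also have "\<dots> \<le> order F ^ (d * l)"
  proof (rule power_increasing)
    have "order F ^ card P \<le> order F ^ d"
      using order_power_card_pivots_le[OF finite_carrier W(1)] W(2) by (simp add: P_def)
    then have "card P \<le> d" by (rule power_le_imp_le_exp[OF order_gt_1])
    moreover have "card P = card P1 + card P2"
      unfolding P1_def P2_def by (rule card_Int_Diff) (simp add: P_def)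
    ultimately have "card P1 + card P2 \<le> d" by simp
    moreover have "card P2 \<le> l - d"
    proof -
      have "P2 \<subseteq> {d..<l}" using P_lt by (auto simp: P2_def)
      from card_mono[OF _ this] show ?thesis by simp
    qed
    moreover have "card Q \<le> card Q1 + card P2 * d"
      unfolding Q_def using card_Un_le[of Q1 "P2 \<times> {..<d}"] by (simp add: card_cartesian_product)
    moreover have "2 * card Q1 = card P1 * (card P1 + 1)"
      unfolding Q1_def by (rule card_ordered_pairs) (rule finP)
    ultimately show "2 * card Q \<le> d * l"
      using triangle_plus_rectangle_le[of "card P1" "card P2" d l] \<open>d < l\<close> by linarith
  qed (use order_gt_1 in auto)
  finally show ?thesis .
qed

end

section \<open>Probabilities for one block and for the whole matrix\<close>

lemma pair_pmf_of_set:
  assumes "finite A" "A \<noteq> {}" "finite B" "B \<noteq> {}"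
  shows "pair_pmf (pmf_of_set A) (pmf_of_set B) = pmf_of_set (A \<times> B)"
proof (rule pmf_eqI)
  fix x :: "'a \<times> 'b"
  show "pmf (pair_pmf (pmf_of_set A) (pmf_of_set B)) x = pmf (pmf_of_set (A \<times> B)) x"
    using assms by (cases x) (simp add: pmf_pair indicator_def card_cartesian_product)
qed

lemma column_join_blocks:
  assumes "j < d" "i < 8"
  shows "column l (join_blocks l d B) (i * d + j) = column l (B i) j"
proof -
  have "i * d + j < Suc i * d" using assms by simp
  also have "\<dots> \<le> 8 * d" using assms by (intro mult_right_mono) auto
  finally have "i * d + j < 8 * d" .
  then show ?thesis
    using assms by (auto simp: column_def join_blocks_def)
qed

context finite_field
begin

text \<open>After squaring, both counts are bounded by whole powers: at most
  \<open>q ^ (d * l)\<close> favourable against at least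
  \<open>q ^ (d * (d + 1) + 2 * (l - d) * d)\<close> in all. The exponents differ by
  \<open>d * (l - d + 1)\<close>.\<close>

lemma prob_random_block_in_subspace_sq_le:
  assumes "d < l" and W: "subspace F W (func_space {..<l})" "card W = order F ^ d"
  shows "measure_pmf.prob (random_block F l d) {B. \<forall>j<d. column l B j \<in> W} ^ 2
    \<le> 1 / real (order F) ^ (d * (l - d + 1))"
proof -
  let ?q = "real (order F)"
  let ?X = "{X \<in> symmetric_matrices F d \<times> matrices F (l - d) d.
      \<forall>j<d. column l (stack_block l d X) j \<in> W}"
  let ?s = "card (symmetric_matrices F d)" and ?t = "card (matrices F (l - d) d)"
  let ?Y = "symmetric_matrices F d \<times> matrices F (l - d) d"
  have q: "?q > 1" using order_gt_1 by simp
  have "measure_pmf.prob (random_block F l d) {B. \<forall>j<d. column l B j \<in> W}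
      = measure_pmf.prob (pmf_of_set ?Y) {X. \<forall>j<d. column l (stack_block l d X) j \<in> W}"
    unfolding random_block_def
    by (simp add: pair_pmf_of_set finite_symmetric_matrices symmetric_matrices_nonempty
        finite_matrices matrices_nonempty vimage_def)
  also have "\<dots> = card (?Y \<inter> {X. \<forall>j<d. column l (stack_block l d X) j \<in> W}) / card ?Y"
    by (rule measure_pmf_of_set)
      (auto simp: finite_symmetric_matrices symmetric_matrices_nonempty finite_matrices matrices_nonempty)
  also have "?Y \<inter> {X. \<forall>j<d. column l (stack_block l d X) j \<in> W} = ?X" by blast
  finally have p: "measure_pmf.prob (random_block F l d) {B. \<forall>j<d. column l B j \<in> W}
      = card ?X / (real ?s * real ?t)"
    by (simp only: card_cartesian_product of_nat_mult)
  have num: "real (card ?X) ^ 2 \<le> ?q ^ (d * l)"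
    using card_blocks_in_subspace_sq_le[OF assms] by (simp only: of_nat_power[symmetric] of_nat_le_iff)
  have "?q ^ (d * (d + 1)) \<le> real ?s ^ 2"
    using order_power_le_card_symmetric_matrices_sq[of d] by (simp only: of_nat_power[symmetric] of_nat_le_iff)
  then have den: "?q ^ (d * (d + 1)) * (?q ^ ((l - d) * d)) ^ 2 \<le> (real ?s * real ?t) ^ 2"
    by (simp add: power_mult_distrib card_matrices mult_right_mono)
  have "(card ?X / (real ?s * real ?t)) ^ 2 = real (card ?X) ^ 2 / (real ?s * real ?t) ^ 2"
    by (rule power_divide)
  also have "\<dots> \<le> ?q ^ (d * l) / (?q ^ (d * (d + 1)) * (?q ^ ((l - d) * d)) ^ 2)"
    using num den q by (intro frac_le) auto
  also have "?q ^ (d * (d + 1)) * (?q ^ ((l - d) * d)) ^ 2 = ?q ^ (d * l) * ?q ^ (d * (l - d + 1))"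
  proof -
    obtain m where "l = d + m" using assms(1) less_imp_add_positive by blast
    then have "d * (d + 1) + (l - d) * d * 2 = d * l + d * (l - d + 1)"
      by (simp add: algebra_simps)
    then show ?thesis by (simp only: power_add[symmetric] power_mult[symmetric])
  qed
  also have "?q ^ (d * l) / (?q ^ (d * l) * ?q ^ (d * (l - d + 1))) = 1 / ?q ^ (d * (l - d + 1))"
    using q by simp
  finally show ?thesis unfolding p .
qed

lemma random_block_in_matrices:
  assumes "d < l" "B \<in> set_pmf (random_block F l d)"
  shows "B \<in> matrices F l d"
proof -
  obtain S M where "B = stack_block l d (S, M)" "S \<in> symmetric_matrices F d"
    "M \<in> matrices F (l - d) d"
    using assms by (auto simp: random_block_def symmetric_matrices_nonempty matrices_nonempty
        finite_matrices finite_symmetric_matrices)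
  then show ?thesis
    using stack_block_in_matrices by (simp add: symmetric_matrices_def)
qed

lemma finite_coord_subspaces:
  "finite {W. subspace F W (func_space {..<l :: nat}) \<and> card W = order F ^ d}"
proof -
  interpret V: vectorspace F "func_space {..<l}" by (rule vectorspace_func_space)
  show ?thesis
    by (rule finite_subset[of _ "Pow (carrier (func_space {..<l}))"])
      (use V.subspaceD(1) finite_coord_space in auto)
qed

text \<open>The bridge between the dimensions that define rank and Gaussian binomial and the
  cardinalities by which subspaces are counted.\<close>

lemma card_subspace_eq_order_power_dim:
  assumes "subspace F W (func_space {..<l})"
  shows "card W = order F ^ subspace_dim F l W"
proof -
  interpret V: vectorspace F "func_space {..<l}" by (rule vectorspace_func_space)
  interpret W: vectorspace F "func_space {..<l}\<lparr>carrier := W\<rparr>"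
    by (rule V.subspace_is_vs[OF assms])
  have "finite W"
    using finite_coord_space V.subspaceD(1)[OF assms] finite_subset by blast
  then show ?thesis
    using W.card_carrier_eq_order_power_dim by (simp add: subspace_dim_def)
qed

text \<open>The span is enlarged to exactly \<open>q ^ d\<close> elements, so that the union bound
  runs over subspaces of a single size; \<open>d \<le> l\<close> leaves room for this.\<close>

lemma subspace_of_dim_containing:
  assumes "d \<le> l" and S: "S \<subseteq> carrier (func_space {..<l})"
    and "subspace_dim F l (module.span F (func_space {..<l}) S) \<le> d"
  shows "\<exists>W. subspace F W (func_space {..<l}) \<and> card W = order F ^ d \<and> S \<subseteq> W"
proof -
  interpret V: vectorspace F "func_space {..<l}" by (rule vectorspace_func_space)
  have U: "subspace F (V.span S) (func_space {..<l})" by (rule V.span_is_subspace[OF S])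
  define r where "r = subspace_dim F l (V.span S)"
  have "r \<le> d" using assms(3) by (simp add: r_def)
  then have "order F ^ (r + (d - r)) \<le> card (carrier (func_space {..<l}))"
    using \<open>d \<le> l\<close> order_gt_1 by (simp add: card_carrier_func_space power_increasing)
  from V.subspace_extend[OF finite_coord_space order_gt_1 U
      card_subspace_eq_order_power_dim[OF U, folded r_def] this] \<open>r \<le> d\<close>
  obtain W where "subspace F W (func_space {..<l})" "V.span S \<subseteq> W" "card W = order F ^ d"
    by auto
  then show ?thesis using V.in_own_span[OF S] by blast
qed

text \<open>A union bound over \<open>W\<close>. For fixed \<open>W\<close> the event constrains
  each block separately, so independence gives the eighth power of the one-block probability. This
  is the fourth power of the bounded square, whence the factor 4 in the exponent.\<close>

lemma prob_rank_le:
  assumes "1 \<le> d" "d < l"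
  shows "measure_pmf.prob (random_C F l d) {C. matrix_rank F l (8 * d) C \<le> d}
    \<le> real (card {W. subspace F W (func_space {..<l}) \<and> card W = order F ^ d})
      / real (order F) ^ (4 * (d * (l - d + 1)))"
proof -
  let ?SS = "{W. subspace F W (func_space {..<l}) \<and> card W = order F ^ d}"
  let ?E = "\<lambda>W. {B. \<forall>j<d. column l B j \<in> W}"
  let ?M = "Pi_pmf {..<8::nat} undefined (\<lambda>_. random_block F l d)"
  let ?A = "{B. matrix_rank F l (8 * d) (join_blocks l d B) \<le> d}"
  \<comment> \<open>On the support the entries are known to lie in the field, so the columns belong
    to the coordinate space.\<close>
  have cover: "?A \<inter> set_pmf ?M \<subseteq> (\<Union>W\<in>?SS. Pi {..<8} (\<lambda>_. ?E W))"
  proof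
    fix B assume B: "B \<in> ?A \<inter> set_pmf ?M"
    then have Bi: "B i \<in> matrices F l d" if "i < 8" for i
      using that random_block_in_matrices[OF \<open>d < l\<close>] by (auto simp: set_Pi_pmf PiE_dflt_def)
    have "column l (join_blocks l d B) ` {..<8 * d} \<subseteq> carrier (func_space {..<l})"
    proof (rule image_subsetI)
      fix j assume "j \<in> {..<8 * d}"
      then have j: "j < 8 * d" "j div d < 8" "j mod d < d"
        using \<open>1 \<le> d\<close> by (auto simp: less_mult_imp_div_less)
      then have "B (j div d) (i, j mod d) \<in> carrier F" if "i < l" for i
        using Bi[OF j(2)] that by (auto simp: matrices_def)
      then show "column l (join_blocks l d B) j \<in> carrier (func_space {..<l})"
        using j by (auto simp: column_def join_blocks_def func_space_def)
    qed
    from subspace_of_dim_containing[OF less_imp_le[OF \<open>d < l\<close>] this] B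
    obtain W where W: "W \<in> ?SS" "column l (join_blocks l d B) ` {..<8 * d} \<subseteq> W"
      by (auto simp: matrix_rank_def)
    have "column l (B i) j \<in> W" if "i < 8" "j < d" for i j
    proof -
      have "i * d + j < Suc i * d" using that by simp
      also have "\<dots> \<le> 8 * d" using that by (intro mult_right_mono) auto
      finally show ?thesis using W(2) column_join_blocks[OF that(2,1), of l B] by (metis image_subset_iff lessThan_iff)
    qed
    then show "B \<in> (\<Union>W\<in>?SS. Pi {..<8} (\<lambda>_. ?E W))" using W(1) by blast
  qed
  have "measure_pmf.prob (random_C F l d) {C. matrix_rank F l (8 * d) C \<le> d} = measure_pmf.prob ?M ?A"
    by (simp add: random_C_def vimage_def)
  also have "\<dots> = measure_pmf.prob ?M (?A \<inter> set_pmf ?M)"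
    by (rule measure_Int_set_pmf[symmetric])
  also have "\<dots> \<le> measure_pmf.prob ?M (\<Union>W\<in>?SS. Pi {..<8} (\<lambda>_. ?E W))"
    by (rule measure_pmf.finite_measure_mono[OF cover]) simp
  also have "\<dots> \<le> (\<Sum>W\<in>?SS. measure_pmf.prob ?M (Pi {..<8} (\<lambda>_. ?E W)))"
    by (rule measure_pmf.finite_measure_subadditive_finite[OF finite_coord_subspaces]) simp
  also have "\<dots> \<le> (\<Sum>W\<in>?SS. 1 / real (order F) ^ (4 * (d * (l - d + 1))))"
  proof (rule sum_mono)
    fix W assume W: "W \<in> ?SS"
    let ?p = "measure_pmf.prob (random_block F l d) (?E W)"
    have "measure_pmf.prob ?M (Pi {..<8} (\<lambda>_. ?E W)) = ?p ^ 8"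
      by (subst measure_Pi_pmf_Pi) auto
    also have "\<dots> = (?p ^ 2) ^ 4" by (simp flip: power_mult)
    also have "\<dots> \<le> (1 / real (order F) ^ (d * (l - d + 1))) ^ 4"
      using prob_random_block_in_subspace_sq_le[OF \<open>d < l\<close>, of W] W by (intro power_mono) auto
    also have "\<dots> = 1 / real (order F) ^ (4 * (d * (l - d + 1)))"
      by (simp add: power_divide power_mult[symmetric] mult.commute)
    finally show "measure_pmf.prob ?M (Pi {..<8} (\<lambda>_. ?E W)) \<le> 1 / real (order F) ^ (4 * (d * (l - d + 1)))" .
  qed
  finally show ?thesis by simp
qed

section \<open>Gaussian binomial and the final estimate\<close>

text \<open>The double count of tuples divides \<open>q ^ (l * d)\<close> by
  \<open>q ^ ((d - 1) * d)\<close>. The true order of magnitude is \<open>q ^ (d * (l - d))\<close>;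
  the extra factor \<open>q ^ d\<close> is absorbed by the large number of blocks.\<close>

lemma card_coord_subspaces_le:
  assumes "d \<le> l"
  shows "card {W. subspace F W (func_space {..<l}) \<and> card W = order F ^ d}
    \<le> order F ^ (d * (l - d + 1))"
proof -
  interpret V: vectorspace F "func_space {..<l}" by (rule vectorspace_func_space)
  let ?S = "{W. subspace F W (func_space {..<l}) \<and> card W = order F ^ d}"
  have "order F ^ ((d - 1) * d) * card ?S \<le> order F ^ (l * d)"
    using V.card_subspaces_le[OF finite_coord_space order_gt_1, of d]
    by (simp add: card_carrier_func_space power_mult)
  \<comment> \<open>Both sides are equal for \<open>d > 0\<close>; the case \<open>d = 0\<close> is
    split off because \<open>d - 1\<close> is truncated.\<close>
  moreover have "l * d \<le> (d - 1) * d + d * (l - d + 1)"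
  proof (cases d)
    case (Suc k)
    define m where "m = l - d"
    have "l = d + m" using assms by (simp add: m_def)
    then show ?thesis using Suc by (simp add: m_def[symmetric] algebra_simps)
  qed simp
  ultimately have "order F ^ ((d - 1) * d) * card ?S \<le> order F ^ ((d - 1) * d + d * (l - d + 1))"
    using order_gt_1 by (meson le_trans less_imp_le power_increasing)
  then have "order F ^ ((d - 1) * d) * card ?S \<le> order F ^ ((d - 1) * d) * order F ^ (d * (l - d + 1))"
    by (simp only: power_add)
  then show ?thesis using order_gt_1 by (simp only: nat_mult_le_cancel1 zero_less_power)
qed

text \<open>By \<open>card_subspace_eq_order_power_dim\<close> the subspaces counted by dimension
  are among those counted by cardinality.\<close>

lemma gaussian_binomial_le:
  assumes "d \<le> l"
  shows "gaussian_binomial F l d \<le> order F ^ (d * (l - d + 1))"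
proof -
  have "gaussian_binomial F l d
      \<le> card {W. subspace F W (func_space {..<l}) \<and> card W = order F ^ d}"
    unfolding gaussian_binomial_def using card_subspace_eq_order_power_dim
    by (intro card_mono finite_coord_subspaces) auto
  also note card_coord_subspaces_le[OF assms]
  finally show ?thesis .
qed

lemma gaussian_binomial_prob_rank_le:
  assumes "1 \<le> d" "d < l"
  shows "real (gaussian_binomial F l d) *
      measure_pmf.prob (random_C F l d) {C. matrix_rank F l (8 * d) C \<le> d}
    \<le> 1 / real (order F) ^ (2 * l)"
proof -
  let ?q = "real (order F)" and ?N = "d * (l - d + 1)"
  have q: "?q > 1" using order_gt_1 by simp
  have "measure_pmf.prob (random_C F l d) {C. matrix_rank F l (8 * d) C \<le> d}
      \<le> real (card {W. subspace F W (func_space {..<l}) \<and> card W = order F ^ d}) / ?q ^ (4 * ?N)"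
    by (rule prob_rank_le[OF assms])
  also have "\<dots> \<le> ?q ^ ?N / ?q ^ (4 * ?N)"
    using card_coord_subspaces_le[of d l] assms q
    by (intro divide_right_mono) (simp_all flip: of_nat_power)
  finally have prob: "measure_pmf.prob (random_C F l d) {C. matrix_rank F l (8 * d) C \<le> d}
      \<le> ?q ^ ?N / ?q ^ (4 * ?N)" .
  have "real (gaussian_binomial F l d) \<le> ?q ^ ?N"
    using gaussian_binomial_le[of d l] assms by (simp flip: of_nat_power)
  then have "real (gaussian_binomial F l d) *
      measure_pmf.prob (random_C F l d) {C. matrix_rank F l (8 * d) C \<le> d}
      \<le> ?q ^ ?N * (?q ^ ?N / ?q ^ (4 * ?N))"
    using prob q by (intro mult_mono) auto
  also have "\<dots> = 1 / ?q ^ (2 * ?N)"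
  proof -
    have "?q ^ (4 * ?N) = ?q ^ ?N * ?q ^ ?N * ?q ^ (2 * ?N)" by (simp flip: power_add)
    then show ?thesis using q by simp
  qed
  also have "\<dots> \<le> 1 / ?q ^ (2 * l)"
  proof -
    \<comment> \<open>\<open>?N\<close> is \<open>d * (l - d) + d\<close>, and
      \<open>d \<ge> 1\<close> makes this at least \<open>(l - d) + d\<close>.\<close>
    have "l - d \<le> d * (l - d)" using assms by simp
    then have "l \<le> ?N" using assms by (simp add: algebra_simps)
    then show ?thesis using q by (intro divide_left_mono power_increasing) auto
  qed
  finally show ?thesis .
qed

end

theorem proposition3p4:
  shows "\<exists>f :: nat \<Rightarrow> real. (\<forall>l. 0 \<le> f l) \<and> f \<in> \<Omega>(\<lambda>l. real l) \<and>
    (\<forall>(F :: 'a ring) l d. field F \<longrightarrow> finite (carrier F) \<longrightarrow> 1 \<le> d \<longrightarrow> d \<le> l - 1 \<longrightarrow>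
       real (gaussian_binomial F l d) *
         measure_pmf.prob (random_C F l d) {C. matrix_rank F l (8 * d) C \<le> d}
       \<le> 1 / real (order F) powr f l)"
\<comment> \<open>The witness \<open>2 * l\<close> is fixed before the field and \<open>d\<close>,
  so the constant behind \<open>\<Omega>\<close> is uniform in both.\<close>
proof (intro exI[of _ "\<lambda>l. real (2 * l)"] conjI allI impI)
  show "(\<lambda>l. real (2 * l)) \<in> \<Omega>(\<lambda>l. real l)" by simp
next
  fix F :: "'a ring" and l d :: nat
  assume F: "field F" "finite (carrier F)" and d: "1 \<le> d" "d \<le> l - 1"
  interpret finite_field F
    by (intro finite_field.intro finite_field_axioms.intro F)
  \<comment> \<open>The subtraction in \<open>d \<le> l - 1\<close> is truncated;
    \<open>1 \<le> d\<close> excludes \<open>l = 0\<close>.\<close>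
  have "d < l" using d by simp
  moreover have "real (order F) powr real (2 * l) = real (order F) ^ (2 * l)"
    using order_gt_1 by (intro powr_realpow) simp
  ultimately show "real (gaussian_binomial F l d) *
         measure_pmf.prob (random_C F l d) {C. matrix_rank F l (8 * d) C \<le> d}
       \<le> 1 / real (order F) powr real (2 * l)"
    using gaussian_binomial_prob_rank_le[OF d(1)] by simp
qed simp

end
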